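(* Let $p\in(1,\infty)$. The function $$f(x)=\frac{\log(\sin_p(x)/x)}{\log\cos_p(x)}$$ is strictly decreasing from $(0,\pi_p/2)$ onto $(0,1/(1+p))$. In particular, for all $p\in(1,\infty)$ and $x\in(0,\pi_p/2)$, $$\cos_p(x)^{\alpha}<\frac{\sin_p(x)}{x}<1$$ with $\alpha=1/(1+p)$, and this constant is best possible (i.e. $1/(1+p)$ is the smallest real $\alpha$ for which the left inequality holds for all $x\in(0,\pi_p/2)$).
   Context: For $1<p<\infty$ define $\arcsin_p(x)=\int_0^x (1-t^p)^{-1/p}\,dt$ for $0\le x\le 1$, and $\pi_p/2=\arcsin_p(1)$. The generalized sine $\sin_p:[0,\pi_p/2]\to[0,1]$ is the inverse of $\arcsin_p$, and the generalized cosine is $\cos_p(x)=\frac{d}{dx}\sin_p(x)=(1-\sin_p(x)^p)^{1/p}$ on $[0,\pi_p/2]$. *)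

theory Defs
  imports "HOL-Analysis.Analysis"
begin

definition arcsin_p :: "real \<Rightarrow> real \<Rightarrow> real" where
  "arcsin_p p x = integral {0..x} (\<lambda>t. (1 - t powr p) powr (- (1 / p)))"

definition pi_p :: "real \<Rightarrow> real" where
  "pi_p p = 2 * arcsin_p p 1"

(* Meaningful on {0..pi_p p / 2} only. *)
definition sin_p :: "real \<Rightarrow> real \<Rightarrow> real" where
  "sin_p p = the_inv_into {0..1} (arcsin_p p)"

(* The derivative is one-sided at the endpoints, since sin_p p is unspecified
   outside {0..pi_p p / 2}. *)
definition cos_p :: "real \<Rightarrow> real \<Rightarrow> real" where
  "cos_p p x = vector_derivative (sin_p p) (at x within {0..pi_p p / 2})"

end

theory Submission
  imports Defs
begin

text \<open>
  Substituting \<open>x = arcsin_p s\<close> turns the quotient into \<open>F s / G s\<close> with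
  \<open>F s = ln (arcsin_p s / s)\<close> and \<open>G s = - ln (1 - s^p) / p\<close>. The monotone form of l'Hopital's
  rule is applied three times: \<open>F' / G'\<close> equals \<open>num / den\<close>, the quotient \<open>num' / den'\<close> equals
  \<open>1 - p / (p r + 1)\<close> with \<open>r = arcsin_p s / (s arcsin_p' s)\<close>, and the derivatives of the
  numerator and denominator of \<open>r\<close> have quotient \<open>1 - s^p\<close>, which decreases from 1. Hence all the
  quotients decrease, and \<open>F / G\<close> tends to \<open>1 / (1 + p)\<close> at 0. At 1 it tends to 0 because
  \<open>arcsin_p 1\<close> is finite while \<open>G\<close> diverges.
\<close>

section \<open>Two general facts about strictly decreasing functions on an open interval\<close>

text \<open>Left of \<open>x\<close> the rate of \<open>f\<close> relative to \<open>g\<close> is at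
  least \<open>q x\<close>, so \<open>q x\<close> is at most \<open>f x / g x\<close>; right of
  \<open>x\<close> the rate is below \<open>q x\<close>, so further growth lowers the quotient.
  Writing the derivative of \<open>f\<close> as \<open>q x * g' x\<close> lets each application
  supply \<open>q\<close> in simplified form.\<close>

lemma monotone_lhopital:
  fixes f g g' q :: "real \<Rightarrow> real"
  assumes f: "\<And>x. a < x \<Longrightarrow> x < b \<Longrightarrow> (f has_real_derivative q x * g' x) (at x)"
    and g: "\<And>x. a < x \<Longrightarrow> x < b \<Longrightarrow> (g has_real_derivative g' x) (at x)"
    and g'_pos: "\<And>x. a < x \<Longrightarrow> x < b \<Longrightarrow> 0 < g' x"
    and q: "strict_antimono_on {a<..<b} q"
    and f0: "(f \<longlongrightarrow> 0) (at_right a)" and g0: "(g \<longlongrightarrow> 0) (at_right a)"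
  shows "strict_antimono_on {a<..<b} (\<lambda>x. f x / g x)"
proof -
  have g_mono: "g x < g y" if "a < x" "x < y" "y < b" for x y
    by (rule DERIV_pos_imp_increasing[OF that(2)]) (meson g g'_pos that less_le_trans le_less_trans)
  have g_pos: "0 < g x" if x: "a < x" "x < b" for x
  proof -
    \<comment> \<open>The limit at \<open>a\<close> yields only a weak inequality, at
      \<open>m\<close>; strictness is regained between \<open>m\<close> and
      \<open>x\<close>.\<close>
    define m where "m = (a + x) / 2"
    have m: "a < m" "m < x" using x by (auto simp: m_def)
    have "eventually (\<lambda>z. g z \<le> g m) (at_right a)"
      unfolding eventually_at_right_field
      by (rule exI[of _ m]) (use m x in \<open>auto intro!: less_imp_le g_mono\<close>)
    then have "0 \<le> g m"
      by (intro tendsto_le[OF _ tendsto_const g0]) auto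
    with g_mono[of m x] m x show ?thesis by simp
  qed
  have left: "q x * g x \<le> f x" if x: "a < x" "x < b" for x
  proof -
    \<comment> \<open>With \<open>q x\<close> frozen, the derivative
      \<open>(q t - q x) * g' t\<close> has a fixed sign on each side of \<open>x\<close>.\<close>
    have *: "f z - q x * g z \<le> f x - q x * g x" if z: "a < z" "z < x" for z
    proof (rule DERIV_nonneg_imp_nondecreasing[where f = "\<lambda>t. f t - q x * g t"])
      fix t assume t: "z \<le> t" "t \<le> x"
      have "q x \<le> q t"
        using monotone_onD[OF q, of t x] t x z by (cases "t = x") auto
      then have "0 \<le> (q t - q x) * g' t"
        using g'_pos[of t] t x z by (intro mult_nonneg_nonneg) auto
      moreover have "((\<lambda>t. f t - q x * g t) has_real_derivative (q t - q x) * g' t) (at t)"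
        using t x z by (auto intro!: derivative_eq_intros f g simp: algebra_simps)
      ultimately show "\<exists>y. ((\<lambda>t. f t - q x * g t) has_real_derivative y) (at t) \<and> 0 \<le> y"
        by blast
    qed (use z in auto)
    have "((\<lambda>z. f z - q x * g z) \<longlongrightarrow> 0 - q x * 0) (at_right a)"
      by (intro tendsto_intros f0 g0)
    moreover have "eventually (\<lambda>z. f z - q x * g z \<le> f x - q x * g x) (at_right a)"
      unfolding eventually_at_right_field by (rule exI[of _ x]) (use x * in auto)
    ultimately have "0 - q x * 0 \<le> f x - q x * g x"
      by (intro tendsto_le[OF _ tendsto_const]) auto
    then show ?thesis by simp
  qed
  have right: "f y - f x < q x * (g y - g x)" if xy: "a < x" "x < y" "y < b" for x y
  proof -
    have "f y - q x * g y < f x - q x * g x"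
    proof (rule DERIV_neg_imp_decreasing_open[where f = "\<lambda>t. f t - q x * g t", OF xy(2)])
      fix t assume t: "x < t" "t < y"
      have "(q t - q x) * g' t < 0"
        using monotone_onD[OF q, of x t] g'_pos[of t] t xy by (intro mult_neg_pos) auto
      moreover have "((\<lambda>t. f t - q x * g t) has_real_derivative (q t - q x) * g' t) (at t)"
        using t xy by (auto intro!: derivative_eq_intros f g simp: algebra_simps)
      ultimately show "\<exists>y. ((\<lambda>t. f t - q x * g t) has_real_derivative y) (at t) \<and> y < 0"
        by blast
    next
      show "continuous_on {x..y} (\<lambda>t. f t - q x * g t)"
      proof (intro continuous_intros continuous_at_imp_continuous_on ballI)
        fix t assume "t \<in> {x..y}"
        then have "a < t" "t < b" using xy by auto
        then show "isCont f t" "isCont g t" using DERIV_isCont f g by blast+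
      qed
    qed
    then show ?thesis by (simp add: algebra_simps)
  qed
  show ?thesis
  proof (rule monotone_onI)
    fix x y assume "x \<in> {a<..<b}" "y \<in> {a<..<b}" and xy: "x < y"
    then have x: "a < x" "x < b" and y: "a < y" "y < b" by auto
    have gx: "0 < g x" and d: "0 < g y - g x" and gy: "0 < g y"
      using g_pos g_mono x y xy by auto
    \<comment> \<open>This replaces \<open>q x\<close> by \<open>f x / g x\<close> in the bound on
      the increment of \<open>f\<close>, which is then the claim up to rearrangement.\<close>
    have "q x \<le> f x / g x"
      using left[OF x] gx by (simp add: field_simps)
    then have "q x * (g y - g x) \<le> f x / g x * (g y - g x)"
      using d by (intro mult_right_mono) auto
    with right[OF x(1) xy y(2)] have "f y - f x < f x / g x * (g y - g x)" by simp
    then have "f y < f x / g x * g y"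
      using gx by (simp add: field_simps)
    then show "f x / g x > f y / g y"
      using gy by (simp add: pos_divide_less_eq)
  qed
qed

text \<open>Strict monotonicity keeps the limits from being attained, and the intermediate value
  theorem applies between a point near \<open>a\<close> and a point near \<open>b\<close>.\<close>

lemma strict_antimono_image_greaterThanLessThan:
  fixes f :: "real \<Rightarrow> real"
  assumes ab: "a < b" and cont: "continuous_on {a<..<b} f"
    and anti: "strict_antimono_on {a<..<b} f"
    and L: "(f \<longlongrightarrow> L) (at_right a)" and M: "(f \<longlongrightarrow> M) (at_left b)"
  shows "f ` {a<..<b} = {M<..<L}"
proof
  have antiD: "f y < f x" if "a < x" "x < y" "y < b" for x y
    using monotone_onD[OF anti, of x y] that by auto
  show "f ` {a<..<b} \<subseteq> {M<..<L}"
  proof (rule image_subsetI)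
    fix x assume "x \<in> {a<..<b}"
    then have x: "a < x" "x < b" by auto
    \<comment> \<open>Points strictly on either side of \<open>x\<close> turn the weak inequalities
      for the limits into strict ones for \<open>f x\<close>.\<close>
    define m n where "m = (a + x) / 2" and "n = (x + b) / 2"
    have mn: "a < m" "m < x" "x < n" "n < b" using x by (auto simp: m_def n_def)
    have "eventually (\<lambda>z. f m \<le> f z) (at_right a)"
      unfolding eventually_at_right_field
      by (rule exI[of _ m]) (use mn in \<open>auto intro!: less_imp_le antiD\<close>)
    then have "f m \<le> L"
      by (intro tendsto_le[OF _ L tendsto_const]) auto
    moreover have "eventually (\<lambda>z. f z \<le> f n) (at_left b)"
      unfolding eventually_at_left_field
      by (rule exI[of _ n]) (use mn in \<open>auto intro!: less_imp_le antiD\<close>)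
    then have "M \<le> f n"
      by (intro tendsto_le[OF _ tendsto_const M]) auto
    ultimately show "f x \<in> {M<..<L}"
      using antiD[of m x] antiD[of x n] mn by auto
  qed
  show "{M<..<L} \<subseteq> f ` {a<..<b}"
  proof
    fix v assume "v \<in> {M<..<L}"
    then have v: "M < v" "v < L" by auto
    have "eventually (\<lambda>z. v < f z) (at_right a)" "eventually (\<lambda>z. f z < v) (at_left b)"
      using order_tendstoD(1)[OF L v(2)] order_tendstoD(2)[OF M v(1)] by auto
    then obtain c d where c: "a < c" "\<And>z. a < z \<Longrightarrow> z < c \<Longrightarrow> v < f z"
      and d: "d < b" "\<And>z. d < z \<Longrightarrow> z < b \<Longrightarrow> f z < v"
      unfolding eventually_at_right_field eventually_at_left_field by blast
    obtain x where x: "a < x" "x < c" "x < b" using dense[of a "min c b"] c ab by auto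
    obtain y where y: "x < y" "d < y" "y < b" using dense[of "max x d" b] x d by auto
    have "\<exists>z\<ge>x. z \<le> y \<and> f z = v"
      using c(2)[of x] d(2)[of y] x y
      by (intro IVT2') (auto intro!: continuous_on_subset[OF cont])
    then show "v \<in> f ` {a<..<b}" using x y by force
  qed
qed

section \<open>The generalized arcsine: integrability, derivative, behaviour at 0\<close>

context
  fixes p :: real
  assumes p: "1 < p"
begin

abbreviation A :: "real \<Rightarrow> real" where "A \<equiv> arcsin_p p"

text \<open>The integrand of \<open>arcsin_p\<close>, which is also its derivative on the open unit
  interval. At \<open>t = 1\<close> it has the default value 0, because
  \<open>0 powr y = 0\<close>.\<close>

definition dA :: "real \<Rightarrow> real" where "dA t = (1 - t powr p) powr (- (1 / p))"

lemma one_minus_powr_pos: "0 \<le> t \<Longrightarrow> t < 1 \<Longrightarrow> 0 < 1 - t powr p"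
  using p powr_less_mono2[of p t 1] by simp

lemma dA_pos: "0 \<le> t \<Longrightarrow> t < 1 \<Longrightarrow> 0 < dA t"
  using one_minus_powr_pos[of t] by (simp add: dA_def)

text \<open>On the unit interval \<open>t powr p\<close> is at most \<open>t\<close>, and the
  negative exponent reverses the order. The right side serves as an integrable majorant.\<close>

lemma dA_le: "0 \<le> t \<Longrightarrow> t \<le> 1 \<Longrightarrow> dA t \<le> (1 - t) powr (- (1 / p))"
proof (cases "t = 1")
  case False
  assume t: "0 \<le> t" "t \<le> 1"
  have "t powr p \<le> t"
    using t p powr_mono'[of 1 p t] by (cases "t = 0") auto
  then show ?thesis
    unfolding dA_def using t p False by (intro powr_mono2') auto
qed (simp add: dA_def)

lemma continuous_on_dA: "continuous_on {0..<1} dA"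
  unfolding dA_def
  by (intro continuous_intros continuous_on_powr' ballI)
     (use p one_minus_powr_pos in \<open>auto simp: less_imp_neq\<close>)

text \<open>The exponent \<open>- (1 / p)\<close> of the majorant exceeds -1, so its singularity at
  1 is integrable; measurability and domination do the rest.\<close>

lemma dA_integrable: "dA integrable_on {0..1}"
proof -
  have "(\<lambda>x. x powr (- (1 / p))) integrable_on {0..1}"
    using has_integral_powr_from_0[of "- (1 / p)" 1] p by (auto simp: has_integral_iff)
  \<comment> \<open>A reflection followed by a shift by 1 moves the singularity from 0 to 1.\<close>
  then have "(\<lambda>x. (- x) powr (- (1 / p))) integrable_on {-1..-0}"
    by (subst Henstock_Kurzweil_Integration.integrable_reflect_real) auto
  then have bound: "(\<lambda>x. (1 - x) powr (- (1 / p))) integrable_on {0..1}"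
    using integrable_on_shift_Icc_real[of "\<lambda>x. (- x) powr (- (1 / p))" "-1" 0 1] by (simp add: o_def)
  have "dA \<in> borel_measurable borel"
    unfolding dA_def[abs_def] by measurable
  then have "dA \<in> borel_measurable (lebesgue_on {0..1})"
    by (intro measurable_restrict_space1 measurable_completion) simp
  then show ?thesis
    by (rule measurable_bounded_by_integrable_imp_integrable_real[OF _ bound])
       (use dA_le in \<open>auto simp: dA_def\<close>)
qed

lemma A_eq: "A x = integral {0..x} dA"
  by (simp add: arcsin_p_def dA_def[abs_def])

lemma continuous_on_A: "continuous_on {0..1} A"
  unfolding A_eq[abs_def] by (rule indefinite_integral_continuous_1[OF dA_integrable])

lemma A_0 [simp]: "A 0 = 0"
  by (simp add: arcsin_p_def)

lemma A_deriv: assumes "0 < s" "s < 1" shows "(A has_real_derivative dA s) (at s)"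
proof -
  \<comment> \<open>Stopping at \<open>b < 1\<close> keeps the integrand continuous on the whole
    interval of integration.\<close>
  define b where "b = (s + 1) / 2"
  have b: "s < b" "b < 1" using assms by (auto simp: b_def)
  have "((\<lambda>x. integral {0..x} dA) has_vector_derivative dA s) (at s within {0..b})"
    using assms b
    by (intro integral_has_vector_derivative continuous_on_subset[OF continuous_on_dA]) auto
  then have "(A has_real_derivative dA s) (at s within {0..b})"
    by (simp add: has_real_derivative_iff_has_vector_derivative A_eq[abs_def])
  moreover have "at s within {0..b} = at s"
    using assms b by (intro at_within_interior) auto
  ultimately show ?thesis by simp
qed

lemma dA_deriv:
  assumes "0 < s" "s < 1"
  shows "(dA has_real_derivative s powr (p - 1) * dA s / (1 - s powr p)) (at s)"
proof -
  have *: "0 < 1 - s powr p" using one_minus_powr_pos assms by simp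
  have "(dA has_real_derivative
      - (1 / p) * (1 - s powr p) powr (- (1 / p) - 1) * (- (p * s powr (p - 1)))) (at s)"
    unfolding dA_def[abs_def] using assms * p
    by (auto intro!: derivative_eq_intros)
  also have "- (1 / p) * (1 - s powr p) powr (- (1 / p) - 1) * (- (p * s powr (p - 1)))
      = s powr (p - 1) * dA s / (1 - s powr p)"
    using * p by (simp add: dA_def powr_diff mult.commute)
  finally show ?thesis .
qed

lemma A_strict_mono: "strict_mono_on {0..1} A"
proof (rule strict_mono_onI)
  fix x y :: real assume xy: "x \<in> {0..1}" "y \<in> {0..1}" "x < y"
  show "A x < A y"
  proof (rule DERIV_pos_imp_increasing_open[OF xy(3)])
    show "continuous_on {x..y} A"
      using xy by (intro continuous_on_subset[OF continuous_on_A]) auto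
    fix t assume "x < t" "t < y"
    with xy have "0 < t" "t < 1" by auto
    then show "\<exists>d. (A has_real_derivative d) (at t) \<and> 0 < d"
      using A_deriv dA_pos by (meson less_imp_le)
  qed
qed

lemma A_pos: "0 < s \<Longrightarrow> s \<le> 1 \<Longrightarrow> 0 < A s"
  using strict_mono_onD[OF A_strict_mono, of 0 s] by simp

text \<open>The integrand exceeds 1 away from 0. This is the source of the upper bound
  \<open>sin_p p x / x < 1\<close>.\<close>

lemma A_gt: assumes "0 < s" "s < 1" shows "s < A s"
proof -
  have "A 0 - 0 < A s - s"
  proof (rule DERIV_pos_imp_increasing_open[where f = "\<lambda>t. A t - t", OF assms(1)])
    fix t assume t: "0 < t" "t < s"
    have "0 < t powr p" "0 < 1 - t powr p" using t assms one_minus_powr_pos by auto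
    then have "1 < dA t"
      unfolding dA_def using p t powr_less_mono2_neg[of "- (1 / p)" "1 - t powr p" 1] by simp
    moreover have "((\<lambda>t. A t - t) has_real_derivative dA t - 1) (at t)"
      using t assms by (auto intro!: derivative_eq_intros A_deriv)
    ultimately show "\<exists>y. ((\<lambda>t. A t - t) has_real_derivative y) (at t) \<and> 0 < y" by force
  qed (use assms in \<open>auto intro!: continuous_intros continuous_on_subset[OF continuous_on_A]\<close>)
  then show ?thesis by simp
qed

lemma eventually_at_right_0_unitI: "(\<And>s. 0 < s \<Longrightarrow> s < 1 \<Longrightarrow> P s) \<Longrightarrow> eventually P (at_right (0::real))"
  by (auto simp: eventually_at_right_field intro!: exI[of _ 1])

lemma powr_tendsto_0: "((\<lambda>s. s powr p) \<longlongrightarrow> 0) (at_right 0)"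
  using p tendsto_powr'[OF tendsto_ident_at tendsto_const, of 0 p] eventually_at_right_0_unitI[of "(\<le>) 0"]
  by simp

lemma dA_tendsto: "(dA \<longlongrightarrow> 1) (at_right 0)"
  unfolding dA_def[abs_def]
  using tendsto_powr[OF tendsto_diff[OF tendsto_const powr_tendsto_0] tendsto_const, of 1 "- (1 / p)"]
  by simp

lemma A_tendsto_0: "(A \<longlongrightarrow> 0) (at_right 0)"
  using continuous_on_A by (auto simp: continuous_on_Icc_at_rightD dest: continuous_on_Icc_at_rightD)

lemma A_over_s_tendsto: "((\<lambda>s. A s / s) \<longlongrightarrow> 1) (at_right 0)"
proof (rule lhopital_right_0[where f' = dA and g' = "\<lambda>_. 1"])
qed (auto intro!: eventually_at_right_0_unitI A_deriv tendsto_eq_intros A_tendsto_0 dA_tendsto)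

section \<open>The innermost quotient\<close>

definition arcsin_ratio :: "real \<Rightarrow> real" where "arcsin_ratio s = A s / (s * dA s)"

text \<open>The product rule gives \<open>dA s\<close> times
  \<open>1 + s powr p / (1 - s powr p)\<close>, which collapses to one fraction. Dividing
  \<open>dA s\<close> by it leaves the decreasing function \<open>1 - s powr p\<close>.\<close>

lemma s_dA_deriv:
  assumes "0 < s" "s < 1"
  shows "((\<lambda>s. s * dA s) has_real_derivative dA s / (1 - s powr p)) (at s)"
proof -
  have "((\<lambda>s. s * dA s) has_real_derivative
      dA s + s * (s powr (p - 1) * dA s / (1 - s powr p))) (at s)"
    using assms by (auto intro!: derivative_eq_intros dA_deriv)
  also have "dA s + s * (s powr (p - 1) * dA s / (1 - s powr p)) = dA s / (1 - s powr p)"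
    using assms p one_minus_powr_pos[of s] by (simp add: powr_diff divide_simps) (simp add: algebra_simps)
  finally show ?thesis .
qed

lemma arcsin_ratio_antimono: "strict_antimono_on {0<..<1} arcsin_ratio"
  unfolding arcsin_ratio_def[abs_def]
proof (rule monotone_lhopital[where q = "\<lambda>s. 1 - s powr p" and g' = "\<lambda>s. dA s / (1 - s powr p)"])
  fix s :: real assume s: "0 < s" "s < 1"
  have *: "0 < 1 - s powr p" using s one_minus_powr_pos by simp
  show "(A has_real_derivative (1 - s powr p) * (dA s / (1 - s powr p))) (at s)"
    using A_deriv[OF s] * by simp
  show "0 < dA s / (1 - s powr p)" using * dA_pos s by simp
next
  show "strict_antimono_on {0<..<1} (\<lambda>s. 1 - s powr p)"
    using p by (intro monotone_onI) (auto intro: powr_less_mono2)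
qed (use s_dA_deriv in \<open>auto intro!: A_tendsto_0 tendsto_eq_intros dA_tendsto\<close>)

lemma arcsin_ratio_tendsto: "(arcsin_ratio \<longlongrightarrow> 1) (at_right 0)"
proof -
  have "((\<lambda>s. A s / s / dA s) \<longlongrightarrow> 1 / 1) (at_right 0)"
    by (intro tendsto_divide A_over_s_tendsto dA_tendsto) auto
  then show ?thesis by (simp add: arcsin_ratio_def[abs_def])
qed

lemma arcsin_ratio_pos: "0 < s \<Longrightarrow> s < 1 \<Longrightarrow> 0 < arcsin_ratio s"
  using A_pos dA_pos by (simp add: arcsin_ratio_def)

section \<open>The quotient of the derivatives of the two logarithms\<close>

text \<open>\<open>num\<close> and \<open>den\<close> come from dividing
  \<open>(s * dA s - A s) / (s * A s)\<close>, the derivative of \<open>ln (A s / s)\<close>, by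
  \<open>s powr (p - 1) / (1 - s powr p)\<close> and clearing fractions.\<close>

definition num :: "real \<Rightarrow> real" where "num s = (1 - s powr p) * (s * dA s - A s)"
definition den :: "real \<Rightarrow> real" where "den s = s powr p * A s"
definition den' :: "real \<Rightarrow> real" where
  "den' s = p * s powr (p - 1) * A s + s powr p * dA s"

lemma den_deriv: "0 < s \<Longrightarrow> s < 1 \<Longrightarrow> (den has_real_derivative den' s) (at s)"
  unfolding den_def[abs_def] den'_def
  by (auto intro!: derivative_eq_intros A_deriv)

lemma den'_pos: "0 < s \<Longrightarrow> s < 1 \<Longrightarrow> 0 < den' s"
  unfolding den'_def using p A_pos[of s] dA_pos[of s]
  by (intro add_pos_pos mult_pos_pos) auto

text \<open>Put \<open>r = arcsin_ratio s\<close>, so that \<open>A s = r * s * dA s\<close>. Then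
  both derivatives contain the factor \<open>s powr p * dA s\<close>, and what remains is
  \<open>p * r + 1 - p\<close> for \<open>num\<close> and \<open>p * r + 1\<close> for
  \<open>den\<close>.\<close>

lemma num_deriv:
  assumes "0 < s" "s < 1"
  shows "(num has_real_derivative (1 - p / (p * arcsin_ratio s + 1)) * den' s) (at s)"
proof -
  have *: "0 < 1 - s powr p" using one_minus_powr_pos assms by simp
  have "(num has_real_derivative
      - (p * s powr (p - 1)) * (s * dA s - A s)
      + (1 - s powr p) * (dA s / (1 - s powr p) - dA s)) (at s)"
    unfolding num_def[abs_def] using assms
    by (intro DERIV_cong[OF DERIV_mult[OF DERIV_diff[OF DERIV_const has_real_derivative_powr] DERIV_diff[OF s_dA_deriv A_deriv]]]) auto
  also have "- (p * s powr (p - 1)) * (s * dA s - A s)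
      + (1 - s powr p) * (dA s / (1 - s powr p) - dA s)
      = - (p * s powr (p - 1)) * (s * dA s - A s) + s powr p * dA s"
    using * by (simp add: field_simps)
  also have "\<dots> = (1 - p / (p * arcsin_ratio s + 1)) * den' s"
  proof -
    have A: "A s = arcsin_ratio s * s * dA s" using assms dA_pos[of s] by (simp add: arcsin_ratio_def)
    have s: "s powr p = s * s powr (p - 1)" using assms by (simp add: powr_diff)
    have "p * arcsin_ratio s + 1 > 0" using arcsin_ratio_pos[OF assms] p by (simp add: add_pos_pos)
    then show ?thesis
      unfolding den'_def A s by (simp add: field_simps)
  qed
  finally show ?thesis .
qed

lemma num_tendsto: "(num \<longlongrightarrow> 0) (at_right 0)"
  unfolding num_def[abs_def]
  using tendsto_mult[OF tendsto_diff[OF tendsto_const powr_tendsto_0, of 1]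
      tendsto_diff[OF tendsto_mult[OF tendsto_ident_at dA_tendsto] A_tendsto_0]]
  by simp

lemma den_tendsto: "(den \<longlongrightarrow> 0) (at_right 0)"
  unfolding den_def[abs_def]
  using tendsto_mult[OF powr_tendsto_0 A_tendsto_0] by simp

text \<open>The quotient of the derivatives is an increasing function of the positive, decreasing
  \<open>arcsin_ratio\<close>.\<close>

lemma num_den_antimono: "strict_antimono_on {0<..<1} (\<lambda>s. num s / den s)"
proof (rule monotone_lhopital[OF num_deriv den_deriv den'_pos _ num_tendsto den_tendsto])
  show "strict_antimono_on {0<..<1} (\<lambda>s. 1 - p / (p * arcsin_ratio s + 1))"
  proof (rule monotone_onI)
    fix x y :: real assume xy: "x \<in> {0<..<1}" "y \<in> {0<..<1}" "x < y"
    have "arcsin_ratio y < arcsin_ratio x" using monotone_onD[OF arcsin_ratio_antimono xy] .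
    moreover have "0 < arcsin_ratio y" using arcsin_ratio_pos xy by auto
    ultimately show "1 - p / (p * arcsin_ratio x + 1) > 1 - p / (p * arcsin_ratio y + 1)"
      using p by (auto intro!: divide_strict_left_mono mult_pos_pos add_pos_pos)
  qed
qed

text \<open>The constant arises here: \<open>arcsin_ratio\<close> tends to 1, so the quotient of the
  derivatives tends to \<open>1 - p / (p + 1)\<close>.\<close>

lemma num_den_tendsto: "((\<lambda>s. num s / den s) \<longlongrightarrow> 1 / (1 + p)) (at_right 0)"
proof (rule lhopital_right_0[where f' = "\<lambda>s. (1 - p / (p * arcsin_ratio s + 1)) * den' s" and g' = den'])
  have "((\<lambda>s. 1 - p / (p * arcsin_ratio s + 1)) \<longlongrightarrow> 1 - p / (p * 1 + 1)) (at_right 0)"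
    using p by (intro tendsto_intros arcsin_ratio_tendsto) auto
  also have "1 - p / (p * 1 + 1) = 1 / (1 + p)" using p by (simp add: field_simps)
  finally have "((\<lambda>s. 1 - p / (p * arcsin_ratio s + 1)) \<longlongrightarrow> 1 / (1 + p)) (at_right 0)" .
  moreover have "eventually (\<lambda>s. 1 - p / (p * arcsin_ratio s + 1)
      = (1 - p / (p * arcsin_ratio s + 1)) * den' s / den' s) (at_right 0)"
    by (rule eventually_at_right_0_unitI) (use den'_pos in force)
  ultimately show "((\<lambda>s. (1 - p / (p * arcsin_ratio s + 1)) * den' s / den' s) \<longlongrightarrow> 1 / (1 + p)) (at_right 0)"
    by (rule Lim_transform_eventually)
next
  show "eventually (\<lambda>s. den s \<noteq> 0) (at_right 0)"
    by (rule eventually_at_right_0_unitI) (use A_pos in \<open>force simp: den_def\<close>)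
  show "eventually (\<lambda>s. den' s \<noteq> 0) (at_right 0)"
    by (rule eventually_at_right_0_unitI) (use den'_pos in force)
qed (auto intro!: num_tendsto den_tendsto eventually_at_right_0_unitI num_deriv den_deriv)

section \<open>The quotient of the logarithms in the variable \<open>s\<close>\<close>

text \<open>At \<open>x = A s\<close>, \<open>F\<close> and \<open>G\<close> are the negated
  logarithms of \<open>sin_p p x / x\<close> and \<open>cos_p p x\<close>. Negating both preserves
  their quotient and makes the derivative of \<open>G\<close> positive, as
  \<open>monotone_lhopital\<close> requires.\<close>

definition F :: "real \<Rightarrow> real" where "F s = ln (A s / s)"
definition G :: "real \<Rightarrow> real" where "G s = - (ln (1 - s powr p) / p)"
definition G' :: "real \<Rightarrow> real" where "G' s = s powr (p - 1) / (1 - s powr p)"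

lemma G_deriv: "0 < s \<Longrightarrow> s < 1 \<Longrightarrow> (G has_real_derivative G' s) (at s)"
  unfolding G_def[abs_def] G'_def using one_minus_powr_pos[of s] p
  by (auto intro!: derivative_eq_intros)

lemma G'_pos: "0 < s \<Longrightarrow> s < 1 \<Longrightarrow> 0 < G' s"
  using one_minus_powr_pos[of s] by (simp add: G'_def)

lemma G_pos: assumes "0 < s" "s < 1" shows "0 < G s"
proof -
  have "ln (1 - s powr p) < 0"
    using assms one_minus_powr_pos[of s] by (simp add: ln_less_zero)
  then show ?thesis using p by (simp add: G_def divide_neg_pos)
qed

lemma F_deriv:
  assumes "0 < s" "s < 1"
  shows "(F has_real_derivative num s / den s * G' s) (at s)"
proof -
  have *: "0 < 1 - s powr p" "0 < A s" using one_minus_powr_pos A_pos assms by auto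
  have "(F has_real_derivative (dA s * s - A s * 1) / (s * s) / (A s / s)) (at s)"
    unfolding F_def[abs_def] using assms *
    by (auto intro!: derivative_eq_intros A_deriv)
  also have "(dA s * s - A s * 1) / (s * s) / (A s / s) = (s * dA s - A s) / (s * A s)"
    using assms * by (simp add: field_simps)
  also have "\<dots> = num s / den s * G' s"
  proof -
    have s: "s powr p = s * s powr (p - 1)" using assms by (simp add: powr_diff)
    have "num s * G' s = (s * dA s - A s) * s powr (p - 1)"
      using * by (simp add: num_def G'_def)
    then show ?thesis
      using assms * by (simp add: den_def s)
  qed
  finally show ?thesis .
qed

lemma F_tendsto: "(F \<longlongrightarrow> 0) (at_right 0)"
  using tendsto_ln[OF A_over_s_tendsto] by (simp add: F_def[abs_def])

lemma G_tendsto: "(G \<longlongrightarrow> 0) (at_right 0)"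
proof -
  have "((\<lambda>s. - (ln (1 - s powr p) / p)) \<longlongrightarrow> - (ln (1 - 0) / p)) (at_right 0)"
    using p by (intro tendsto_intros powr_tendsto_0) auto
  then show ?thesis by (simp add: G_def[abs_def])
qed

lemma FG_antimono: "strict_antimono_on {0<..<1} (\<lambda>s. F s / G s)"
  by (rule monotone_lhopital[OF F_deriv G_deriv G'_pos num_den_antimono F_tendsto G_tendsto])

lemma FG_tendsto_0: "((\<lambda>s. F s / G s) \<longlongrightarrow> 1 / (1 + p)) (at_right 0)"
proof (rule lhopital_right_0[where f' = "\<lambda>s. num s / den s * G' s" and g' = G'])
  have "eventually (\<lambda>s. num s / den s = num s / den s * G' s / G' s) (at_right 0)"
    by (rule eventually_at_right_0_unitI) (use G'_pos in force)
  then show "((\<lambda>s. num s / den s * G' s / G' s) \<longlongrightarrow> 1 / (1 + p)) (at_right 0)"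
    by (rule Lim_transform_eventually[OF num_den_tendsto])
  show "eventually (\<lambda>s. G s \<noteq> 0) (at_right 0)"
    by (rule eventually_at_right_0_unitI) (use G_pos in force)
  show "eventually (\<lambda>s. G' s \<noteq> 0) (at_right 0)"
    by (rule eventually_at_right_0_unitI) (use G'_pos in force)
qed (rule F_tendsto G_tendsto eventually_at_right_0_unitI F_deriv G_deriv | assumption)+

lemma FG_tendsto_1: "((\<lambda>s. F s / G s) \<longlongrightarrow> 0) (at_left 1)"
proof -
  have "(A \<longlongrightarrow> A 1) (at_left 1)"
    using continuous_on_Icc_at_leftD[OF continuous_on_A] by simp
  then have F: "(F \<longlongrightarrow> ln (A 1 / 1)) (at_left 1)"
    unfolding F_def[abs_def] using A_pos[of 1]
    by (intro tendsto_intros) auto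
  \<comment> \<open>The approach to 0 is through positive values, so the logarithm diverges to minus
    infinity.\<close>
  have "filterlim (\<lambda>s. 1 - s powr p) (at_right 0) (at_left 1)"
  proof (rule filterlim_at_withinI)
    show "((\<lambda>s. 1 - s powr p) \<longlongrightarrow> 0) (at_left 1)"
      by (auto intro!: tendsto_eq_intros)
    show "eventually (\<lambda>s. 1 - s powr p \<in> {0<..} - {0}) (at_left 1)"
      using one_minus_powr_pos
      by (auto simp: eventually_at_left_field intro!: exI[of _ 0])
  qed
  then have "filterlim (\<lambda>s. ln (1 - s powr p)) at_bot (at_left 1)"
    by (rule filterlim_compose[OF ln_at_0])
  then have "filterlim (\<lambda>s. 1 / p * - ln (1 - s powr p)) at_top (at_left 1)"
    using p by (intro filterlim_tendsto_pos_mult_at_top[OF tendsto_const])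
      (auto simp: filterlim_uminus_at_bot)
  then have "filterlim G at_infinity (at_left 1)"
    by (auto simp: G_def[abs_def] intro: filterlim_at_top_imp_at_infinity)
  then show ?thesis by (rule tendsto_divide_0[OF F])
qed

lemma FG_image: "(\<lambda>s. F s / G s) ` {0<..<1} = {0<..<1 / (1 + p)}"
proof (rule strict_antimono_image_greaterThanLessThan[OF _ _ FG_antimono FG_tendsto_0 FG_tendsto_1])
  show "continuous_on {0<..<1} (\<lambda>s. F s / G s)"
  proof (intro continuous_at_imp_continuous_on ballI)
    fix s :: real assume "s \<in> {0<..<1}"
    then have s: "0 < s" "s < 1" by auto
    then show "isCont (\<lambda>s. F s / G s) s"
      using DERIV_isCont[OF DERIV_divide[OF F_deriv G_deriv]] G_pos by force
  qed
qed simp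

section \<open>Transfer to the generalized sine and cosine\<close>

lemma half_pi_p: "pi_p p / 2 = A 1"
  by (simp add: pi_p_def)

lemma A_image: "A ` {0..1} = {0..A 1}"
proof
  show "A ` {0..1} \<subseteq> {0..A 1}"
    using strict_mono_on_leD[OF A_strict_mono, of 0] strict_mono_on_leD[OF A_strict_mono, of _ 1]
    by auto
  show "{0..A 1} \<subseteq> A ` {0..1}"
  proof
    fix y assume "y \<in> {0..A 1}"
    then show "y \<in> A ` {0..1}"
      using IVT'[of A 0 y 1] continuous_on_A by auto
  qed
qed

lemma A_inj: "inj_on A {0..1}"
  by (rule strict_mono_on_imp_inj_on[OF A_strict_mono])

lemma A_image_open: "A ` {0<..<1} = {0<..<A 1}"
proof -
  \<comment> \<open>By injectivity the image of this difference is the difference of the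
    images.\<close>
  have "{0<..<1} = {0..1} - {0, 1::real}" by auto
  then have "A ` {0<..<1} = A ` {0..1} - A ` {0, 1}"
    by (simp add: inj_on_image_set_diff[OF A_inj])
  then show ?thesis by (auto simp: A_image)
qed

lemma sin_A: "0 \<le> s \<Longrightarrow> s \<le> 1 \<Longrightarrow> sin_p p (A s) = s"
  unfolding sin_p_def by (rule the_inv_into_f_f[OF A_inj]) simp

text \<open>The inverse function rule gives the reciprocal of \<open>dA s\<close>.\<close>

lemma cos_A: assumes "0 < s" "s < 1" shows "cos_p p (A s) = (1 - s powr p) powr (1 / p)"
proof -
  have As: "0 < A s" "A s < A 1"
    using A_image_open assms by (metis greaterThanLessThan_iff image_eqI)+
  \<comment> \<open>Compactness of the unit interval makes the inverse continuous, which the inverse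
    function rule needs.\<close>
  have "continuous_on (A ` {0..1}) (sin_p p)"
    by (rule continuous_on_inv[OF continuous_on_A]) (auto simp: sin_A)
  then have cont: "continuous_on {0..A 1} (sin_p p)" by (simp add: A_image)
  have "(sin_p p has_real_derivative inverse (dA s)) (at (A s))"
  proof (rule DERIV_inverse_function[where f = A and a = 0 and b = "A 1"])
    show "(A has_real_derivative dA s) (at (sin_p p (A s)))"
      using A_deriv assms by (simp add: sin_A)
    show "dA s \<noteq> 0" using dA_pos[of s] assms by simp
    fix y assume "0 < y" "y < A 1"
    then obtain u where "0 < u" "u < 1" "y = A u" using A_image_open by (metis greaterThanLessThan_iff imageE)
    then show "A (sin_p p y) = y" by (simp add: sin_A)
  next
    show "isCont (sin_p p) (A s)"
      using continuous_on_interior[OF cont, of "A s"] As by simp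
  qed (use As in auto)
  \<comment> \<open>\<open>cos_p\<close> is a derivative within the closed interval; at an interior
    point it agrees with the two-sided one.\<close>
  moreover have "at (A s) within {0..pi_p p / 2} = at (A s)"
    unfolding half_pi_p using As by (intro at_within_interior) auto
  ultimately have "cos_p p (A s) = inverse (dA s)"
    by (simp add: cos_p_def has_real_derivative_iff_has_vector_derivative vector_derivative_at)
  then show ?thesis by (simp add: dA_def powr_minus)
qed

lemma ln_cos_A: "0 < s \<Longrightarrow> s < 1 \<Longrightarrow> ln (cos_p p (A s)) = - G s"
  using p one_minus_powr_pos[of s] by (simp add: cos_A ln_powr G_def)

lemma ln_sin_A: "0 < s \<Longrightarrow> s < 1 \<Longrightarrow> ln (sin_p p (A s) / A s) = - F s"
  using A_pos[of s] by (simp add: sin_A F_def ln_div)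

lemma quotient_A:
  "0 < s \<Longrightarrow> s < 1 \<Longrightarrow> ln (sin_p p (A s) / A s) / ln (cos_p p (A s)) = F s / G s"
  by (simp add: ln_cos_A ln_sin_A)

text \<open>Taking logarithms gives \<open>F s < \<alpha> * G s\<close>, and \<open>G s\<close> is
  positive. With an arbitrary exponent this serves both the lower bound and its sharpness.\<close>

lemma cos_powr_less_iff:
  assumes "0 < s" "s < 1"
  shows "cos_p p (A s) powr \<alpha> < sin_p p (A s) / A s \<longleftrightarrow> F s / G s < \<alpha>"
proof -
  have c: "0 < cos_p p (A s)" using p assms one_minus_powr_pos[of s] by (simp add: cos_A)
  have q: "0 < sin_p p (A s) / A s" using assms A_pos[of s] by (simp add: sin_A)
  have "cos_p p (A s) powr \<alpha> < sin_p p (A s) / A s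
      \<longleftrightarrow> ln (cos_p p (A s) powr \<alpha>) < ln (sin_p p (A s) / A s)"
    using c q by (intro ln_less_cancel_iff[symmetric]) auto
  also have "\<dots> \<longleftrightarrow> F s < \<alpha> * G s"
    using c by (simp only: ln_sin_A[OF assms] ln_powr ln_cos_A[OF assms]) simp
  also have "\<dots> \<longleftrightarrow> F s / G s < \<alpha>"
    using G_pos[OF assms] by (simp add: pos_divide_less_eq)
  finally show ?thesis .
qed

end

theorem theorem3p6:
  fixes p :: real
  assumes "1 < p"
  shows "(let f = (\<lambda>x. ln (sin_p p x / x) / ln (cos_p p x))
          in strict_antimono_on {0<..<pi_p p / 2} f
             \<and> f ` {0<..<pi_p p / 2} = {0<..<1 / (1 + p)})
    \<and> (\<forall>x\<in>{0<..<pi_p p / 2}.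
          cos_p p x powr (1 / (1 + p)) < sin_p p x / x \<and> sin_p p x / x < 1)
    \<and> (\<forall>\<alpha>::real. (\<forall>x\<in>{0<..<pi_p p / 2}. cos_p p x powr \<alpha> < sin_p p x / x)
          \<longrightarrow> 1 / (1 + p) \<le> \<alpha>)"
proof -
  let ?A = "arcsin_p p" and ?\<phi> = "\<lambda>s. F p s / G p s"
  let ?f = "\<lambda>x. ln (sin_p p x / x) / ln (cos_p p x)"
  have dom: "{0<..<pi_p p / 2} = ?A ` {0<..<1}"
    by (simp add: half_pi_p[OF assms] A_image_open[OF assms])
  have "strict_antimono_on {0<..<pi_p p / 2} ?f"
    unfolding dom
  proof (rule monotone_onI, elim imageE)
    fix x y s t assume *: "x < y" "x = ?A s" "y = ?A t" "s \<in> {0<..<1}" "t \<in> {0<..<1}"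
    then have "s < t"
      using strict_mono_on_leD[OF A_strict_mono[OF assms], of t s] by force
    then show "?f x > ?f y"
      using monotone_onD[OF FG_antimono[OF assms], of s t] * by (simp add: quotient_A[OF assms])
  qed
  moreover have image: "?f ` {0<..<pi_p p / 2} = {0<..<1 / (1 + p)}"
    unfolding dom image_image FG_image[OF assms, symmetric]
    by (intro image_cong) (simp_all add: quotient_A[OF assms])
  moreover have "cos_p p x powr (1 / (1 + p)) < sin_p p x / x \<and> sin_p p x / x < 1"
    if x: "x \<in> {0<..<pi_p p / 2}" for x
  proof -
    obtain s where s: "0 < s" "s < 1" and xs: "x = ?A s" using x unfolding dom by auto
    have "?\<phi> s \<in> ?\<phi> ` {0<..<1}" using s by (intro imageI) simp
    then have "?\<phi> s < 1 / (1 + p)" by (simp add: FG_image[OF assms])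
    then have "cos_p p x powr (1 / (1 + p)) < sin_p p x / x"
      unfolding xs cos_powr_less_iff[OF assms s] .
    moreover have "sin_p p x / x < 1"
      using s A_gt[OF assms s] by (simp add: xs sin_A[OF assms])
    ultimately show ?thesis ..
  qed
  moreover have "1 / (1 + p) \<le> \<alpha>"
    if \<alpha>: "\<forall>x\<in>{0<..<pi_p p / 2}. cos_p p x powr \<alpha> < sin_p p x / x" for \<alpha> :: real
  \<comment> \<open>Every \<open>v\<close> strictly between 0 and \<open>1 / (1 + p)\<close> is a
    value of \<open>F / G\<close>, hence lies below \<open>\<alpha>\<close>; the bound itself is not
    attained, so density finishes the argument.\<close>
  proof (rule dense_le_bounded[of 0])
    show "0 < 1 / (1 + p)" using assms by simp
    fix v assume "0 < v" "v < 1 / (1 + p)"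
    then have "v \<in> ?\<phi> ` {0<..<1}" by (simp add: FG_image[OF assms])
    then obtain s where s: "0 < s" "s < 1" and v: "v = ?\<phi> s" by auto
    have "cos_p p (?A s) powr \<alpha> < sin_p p (?A s) / ?A s"
      using \<alpha> s unfolding dom by simp
    then show "v \<le> \<alpha>"
      unfolding v cos_powr_less_iff[OF assms s] by simp
  qed
  ultimately show ?thesis unfolding Let_def by blast
qed

end
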